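(* Let $G$ be a connected graph on $n$ vertices with chromatic number $\chi$, and let $b_\chi=n+\lceil n/\chi\rceil$. Assume that $G$ contains a clique $H$ of size $s\ge 2$ such that $N_G(v)\setminus H=N$ for every $v\in H$, for some fixed set $N\subseteq V(G)\setminus H$. Let $R=V(G)\setminus(H\cup N)$, so $|R|=n-s-|N|$. Then the following hold. (a) $\mathcal{D}^{L}(G)$ has an eigenvalue $\lambda_H=\operatorname{Tr}_G(v)+1$ with multiplicity at least $s-1$, for any $v\in H$. (b) $\lambda_H\ge 2n-s-|N|$. (c) If $s+|N|\le n-\lceil n/\chi\rceil$, then $\lambda_H\ge b_\chi$, and hence $\mu_G([b_\chi,\partial_1^L(G)])\ge s-1$.
   Context: Graphs are finite, simple and undirected. For a connected graph $G$ with vertices $v_1,\dots,v_n$, let $d_G(u,v)$ be the length of a shortest $u$–$v$ path, $D(G)=(d_G(v_i,v_j))_{i,j}$ the distance matrix, and $\operatorname{Tr}_G(v)=\sum_{u\in V(G)}d_G(u,v)$ the transmission of $v$. The distance Laplacian matrix is $\mathcal{D}^{L}(G)=\operatorname{diag}(\operatorname{Tr}_G(v_1),\dots,\operatorname{Tr}_G(v_n))-D(G)$, a real symmetric positive semidefinite matrix with $\mathcal{D}^{L}(G)\mathbf 1=\mathbf 0$. Its eigenvalues, listed with multiplicity, are ordered $\partial^{L}_1(G)\ge\partial^{L}_2(G)\ge\cdots\ge\partial^{L}_n(G)=0$. For a real interval $I$, $\mu_G(I)$ is the number of eigenvalues of $\mathcal{D}^{L}(G)$ in $I$, counted with multiplicity.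 $N_G(v)=\{u\in V(G):\{u,v\}\in E(G)\}$ is the open neighborhood of $v$. *)

theory Defs
  imports "Jordan_Normal_Form.Char_Poly"
begin

text \<open>A graph is given by a vertex set \<open>V\<close> and a set \<open>E\<close> of unordered pairs of distinct vertices.\<close>

definition simple_graph :: "'a set \<Rightarrow> 'a set set \<Rightarrow> bool" where
  "simple_graph V E \<longleftrightarrow> finite V \<and> (\<forall>e\<in>E. e \<subseteq> V \<and> card e = 2)"

text \<open>Paths are nonempty lists of vertices, so that a path \<open>p\<close> has length (number of edges)
  \<open>length p - 1\<close>.\<close>

definition is_path :: "'a set \<Rightarrow> 'a set set \<Rightarrow> 'a \<Rightarrow> 'a list \<Rightarrow> 'a \<Rightarrow> bool" where
  "is_path V E u p v \<longleftrightarrow>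
     p \<noteq> [] \<and> set p \<subseteq> V \<and> distinct p \<and> hd p = u \<and> last p = v \<and>
     successively (\<lambda>x y. {x, y} \<in> E) p"

definition connected_graph :: "'a set \<Rightarrow> 'a set set \<Rightarrow> bool" where
  "connected_graph V E \<longleftrightarrow>
     simple_graph V E \<and> V \<noteq> {} \<and> (\<forall>u\<in>V. \<forall>v\<in>V. \<exists>p. is_path V E u p v)"

text \<open>The value is meaningful only if \<open>u\<close> and \<open>v\<close> are joined by a path.\<close>

definition graph_dist :: "'a set \<Rightarrow> 'a set set \<Rightarrow> 'a \<Rightarrow> 'a \<Rightarrow> nat" where
  "graph_dist V E u v = (LEAST k. \<exists>p. is_path V E u p v \<and> length p - 1 = k)"

definition transmission :: "'a set \<Rightarrow> 'a set set \<Rightarrow> 'a \<Rightarrow> nat" where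
  "transmission V E v = (\<Sum>u\<in>V. graph_dist V E u v)"

definition neighborhood :: "'a set \<Rightarrow> 'a set set \<Rightarrow> 'a \<Rightarrow> 'a set" where
  "neighborhood V E v = {u \<in> V. {u, v} \<in> E}"

definition is_clique :: "'a set \<Rightarrow> 'a set set \<Rightarrow> 'a set \<Rightarrow> bool" where
  "is_clique V E H \<longleftrightarrow> H \<subseteq> V \<and> (\<forall>u\<in>H. \<forall>v\<in>H. u \<noteq> v \<longrightarrow> {u, v} \<in> E)"

definition proper_coloring :: "'a set \<Rightarrow> 'a set set \<Rightarrow> nat \<Rightarrow> ('a \<Rightarrow> nat) \<Rightarrow> bool" where
  "proper_coloring V E k c \<longleftrightarrow>
     (\<forall>v\<in>V. c v < k) \<and> (\<forall>u\<in>V. \<forall>v\<in>V. {u, v} \<in> E \<longrightarrow> c u \<noteq> c v)"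

definition chromatic_number :: "'a set \<Rightarrow> 'a set set \<Rightarrow> nat" where
  "chromatic_number V E = (LEAST k. \<exists>c. proper_coloring V E k c)"

text \<open>The matrices depend on an enumeration \<open>vs\<close> of the vertices, that is, a distinct list with
  \<open>set vs = V\<close>; rows and columns are indexed from 0.\<close>

definition distance_matrix :: "'a set \<Rightarrow> 'a set set \<Rightarrow> 'a list \<Rightarrow> real mat" where
  "distance_matrix V E vs =
     mat (length vs) (length vs) (\<lambda>(i, j). real (graph_dist V E (vs ! i) (vs ! j)))"

definition distance_laplacian :: "'a set \<Rightarrow> 'a set set \<Rightarrow> 'a list \<Rightarrow> real mat" where
  "distance_laplacian V E vs =
     mat_diag (length vs) (\<lambda>i. real (transmission V E (vs ! i))) - distance_matrix V E vs"

text \<open>The eigenvalues with multiplicity, as the multiset of real roots of the characteristic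
  polynomial. The matrix is real symmetric, so these are all its eigenvalues, and algebraic and
  geometric multiplicities agree.\<close>

definition dl_eigenvalues :: "'a set \<Rightarrow> 'a set set \<Rightarrow> 'a list \<Rightarrow> real multiset" where
  "dl_eigenvalues V E vs = proots (char_poly (distance_laplacian V E vs))"

text \<open>The \<open>i\<close>-th largest eigenvalue, counted from \<open>i = 1\<close>.\<close>

definition dl_eig :: "'a set \<Rightarrow> 'a set set \<Rightarrow> 'a list \<Rightarrow> nat \<Rightarrow> real" where
  "dl_eig V E vs i = rev (sorted_list_of_multiset (dl_eigenvalues V E vs)) ! (i - 1)"

definition dl_count :: "'a set \<Rightarrow> 'a set set \<Rightarrow> 'a list \<Rightarrow> real set \<Rightarrow> nat" where
  "dl_count V E vs I = size (filter_mset (\<lambda>x. x \<in> I) (dl_eigenvalues V E vs))"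

end

theory Submission
  imports Defs
begin

text \<open>
  Any two vertices of the clique \<open>H\<close> have the same neighbours apart from each other, so
  exchanging them is an automorphism of the graph. Automorphisms preserve distances
  (\<open>graph_dist_automorphism\<close>), whence all vertices of \<open>H\<close> have the same transmission \<open>t\<close> and the
  same distance to every third vertex. Two rows of the distance Laplacian indexed by
  \<open>u, v \<in> H\<close> therefore differ only in the columns of \<open>u\<close> and \<open>v\<close>, where the differences are
  \<open>t + 1\<close> and \<open>- (t + 1)\<close>. In other words, the vectors \<open>e\<^sub>u - e\<^sub>v\<close> are left eigenvectors for
  \<open>\<lambda> = t + 1\<close>.

  The multiplicity of an eigenvalue is counted as that of a root of the characteristic
  polynomial. So, instead of passing from a geometric to an algebraic multiplicity, row operations
  on \<open>x I - A\<close> are used: subtracting the row of one fixed vertex of \<open>H\<close> from the rows of the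
  others produces a factor \<open>x - \<lambda>\<close> in each of these \<open>s - 1\<close> rows
  (\<open>char_poly_dvd_if_row_differences\<close>).

  For the bound on \<open>\<lambda>\<close>, seen from a vertex of \<open>H\<close> the other vertices of \<open>H\<close> and those of \<open>N\<close>
  are at distance at least 1, and all the remaining ones at distance at least 2. The last claim
  follows from it, because the largest eigenvalue is at least \<open>\<lambda>\<close>.
\<close>

section \<open>Distances in a connected graph\<close>

lemma shortest_path_exists:
  assumes "connected_graph V E" "u \<in> V" "v \<in> V"
  obtains p where "is_path V E u p v" "length p = Suc (graph_dist V E u v)"
proof -
  from assms obtain q where "is_path V E u q v"
    unfolding connected_graph_def by blast
  then have "\<exists>k. \<exists>p. is_path V E u p v \<and> length p - 1 = k" by blast
  from LeastI_ex[OF this] obtain p where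
    "is_path V E u p v" "length p - 1 = graph_dist V E u v"
    unfolding graph_dist_def by blast
  moreover from this have "p \<noteq> []" by (simp add: is_path_def)
  ultimately show ?thesis using that by (cases p) auto
qed

lemma graph_dist_le_path_length:
  "is_path V E u p v \<Longrightarrow> graph_dist V E u v \<le> length p - 1"
  unfolding graph_dist_def by (rule Least_le) blast

lemma graph_dist_self:
  assumes "u \<in> V"
  shows "graph_dist V E u u = 0"
  using graph_dist_le_path_length[of V E u "[u]" u] assms by (simp add: is_path_def)

lemma graph_dist_ge_1:
  assumes "connected_graph V E" "u \<in> V" "v \<in> V" "u \<noteq> v"
  shows "1 \<le> graph_dist V E u v"
proof (rule ccontr)
  assume "\<not> ?thesis"
  with shortest_path_exists[OF assms(1-3)] obtain p
    where p: "is_path V E u p v" "length p = Suc 0" by (metis not_less_eq_eq One_nat_def le0 le_antisym)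
  then show False using assms(4) by (auto simp: is_path_def length_Suc_conv)
qed

lemma graph_dist_ge_2:
  assumes "connected_graph V E" "u \<in> V" "v \<in> V" "u \<noteq> v" "{u, v} \<notin> E"
  shows "2 \<le> graph_dist V E u v"
proof (rule ccontr)
  assume "\<not> ?thesis"
  with graph_dist_ge_1[OF assms(1-4)] have "graph_dist V E u v = 1" by simp
  with shortest_path_exists[OF assms(1-3)] obtain p
    where "is_path V E u p v" "length p = Suc (Suc 0)" by (metis One_nat_def)
  then show False using assms(5) by (auto simp: is_path_def length_Suc_conv)
qed

lemma graph_dist_adjacent:
  assumes "connected_graph V E" "u \<in> V" "v \<in> V" "u \<noteq> v" "{u, v} \<in> E"
  shows "graph_dist V E u v = 1"
  using graph_dist_le_path_length[of V E u "[u, v]" v] graph_dist_ge_1[OF assms(1-4)] assms(2-5)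
  by (simp add: is_path_def)

section \<open>Automorphisms and twin vertices\<close>

lemma is_path_map:
  assumes "is_path V E x p y" "inj_on f V" "f ` V \<subseteq> V"
    and "\<And>a b. a \<in> V \<Longrightarrow> b \<in> V \<Longrightarrow> {a, b} \<in> E \<Longrightarrow> {f a, f b} \<in> E"
  shows "is_path V E (f x) (map f p) (f y)"
proof -
  have p: "p \<noteq> []" "set p \<subseteq> V" "distinct p" "hd p = x" "last p = y"
      "successively (\<lambda>x y. {x, y} \<in> E) p"
    using assms(1) by (auto simp: is_path_def)
  have "successively (\<lambda>x y. {f x, f y} \<in> E) p"
    by (rule successively_mono[OF p(6)]) (use p(2) assms(4) in blast)
  moreover have "distinct (map f p)"
    using p(2,3) assms(2) by (simp add: distinct_map inj_on_subset)
  ultimately show ?thesis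
    using p assms(3) by (auto simp: is_path_def successively_map hd_map last_map)
qed

lemma graph_dist_automorphism:
  assumes f: "bij_betw f V V"
    and edges: "\<And>a b. a \<in> V \<Longrightarrow> b \<in> V \<Longrightarrow> {f a, f b} \<in> E \<longleftrightarrow> {a, b} \<in> E"
    and "x \<in> V" "y \<in> V"
  shows "graph_dist V E (f x) (f y) = graph_dist V E x y"
proof -
  let ?g = "inv_into V f"
  have g: "bij_betw ?g V V" using f by (rule bij_betw_inv_into)
  have fg: "f (?g a) = a" if "a \<in> V" for a using f that by (simp add: bij_betw_inv_into_right)
  have gf: "?g (f a) = a" if "a \<in> V" for a using f that by (simp add: bij_betw_inv_into_left)
  have gV: "?g a \<in> V" if "a \<in> V" for a using g that by (auto simp: bij_betw_def)
  have "(\<exists>p. is_path V E (f x) p (f y) \<and> length p - 1 = k) \<longleftrightarrow>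
        (\<exists>p. is_path V E x p y \<and> length p - 1 = k)" (is "?L \<longleftrightarrow> ?R") for k
  proof
    assume ?L
    then obtain p where p: "is_path V E (f x) p (f y)" "length p - 1 = k" by blast
    have "is_path V E (?g (f x)) (map ?g p) (?g (f y))"
    proof (rule is_path_map[OF p(1)])
      show "{?g a, ?g b} \<in> E" if "a \<in> V" "b \<in> V" "{a, b} \<in> E" for a b
        using edges[OF gV[OF that(1)] gV[OF that(2)]] that fg by simp
    qed (use g in \<open>auto simp: bij_betw_def\<close>)
    with p(2) show ?R using gf assms(3,4) by (metis length_map)
  next
    assume ?R
    then obtain p where p: "is_path V E x p y" "length p - 1 = k" by blast
    have "is_path V E (f x) (map f p) (f y)"
      by (rule is_path_map[OF p(1)]) (use f edges in \<open>auto simp: bij_betw_def\<close>)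
    with p(2) show ?L by (metis length_map)
  qed
  then show ?thesis unfolding graph_dist_def by simp
qed

lemma transmission_automorphism:
  assumes f: "bij_betw f V V"
    and edges: "\<And>a b. a \<in> V \<Longrightarrow> b \<in> V \<Longrightarrow> {f a, f b} \<in> E \<longleftrightarrow> {a, b} \<in> E"
    and "x \<in> V"
  shows "transmission V E (f x) = transmission V E x"
proof -
  have "transmission V E (f x) = (\<Sum>u\<in>V. graph_dist V E (f u) (f x))"
    unfolding transmission_def by (rule sum.reindex_bij_betw[OF f, symmetric])
  also have "\<dots> = transmission V E x"
    unfolding transmission_def
    by (rule sum.cong) (auto intro!: graph_dist_automorphism[OF f edges] simp: assms(3))
  finally show ?thesis .
qed

text \<open>The exchange of twins maps a possible edge between them to itself, and every other edge at
  one of them to the corresponding edge at the other. Absence of loops excludes a third case.\<close>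

lemma transpose_twins_edge:
  assumes "simple_graph V E"
    and twins: "\<And>y. y \<noteq> u \<Longrightarrow> y \<noteq> v \<Longrightarrow> {u, y} \<in> E \<longleftrightarrow> {v, y} \<in> E"
  shows "{Transposition.transpose u v a, Transposition.transpose u v b} \<in> E \<longleftrightarrow> {a, b} \<in> E"
proof -
  define adj where "adj x y \<longleftrightarrow> {x, y} \<in> E" for x y
  have irrefl: "\<not> adj x x" for x using assms(1) by (auto simp: simple_graph_def adj_def)
  have sym: "adj x y \<longleftrightarrow> adj y x" for x y by (simp add: adj_def insert_commute)
  have twins: "adj u y \<longleftrightarrow> adj v y" if "y \<noteq> u" "y \<noteq> v" for y
    using twins that by (simp add: adj_def)
  then have twins': "adj y u \<longleftrightarrow> adj y v" if "y \<noteq> u" "y \<noteq> v" for y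
    using that sym[of y u] sym[of y v] by simp
  have "adj (Transposition.transpose u v a) (Transposition.transpose u v b) \<longleftrightarrow> adj a b"
  proof (cases "a \<in> {u, v}"; cases "b \<in> {u, v}")
    assume "a \<in> {u, v}" "b \<in> {u, v}"
    then show ?thesis using sym[of u v] irrefl[of u] irrefl[of v] by fastforce
  next
    assume "a \<in> {u, v}" "b \<notin> {u, v}"
    then show ?thesis using twins[of b] by fastforce
  next
    assume "a \<notin> {u, v}" "b \<in> {u, v}"
    then show ?thesis using twins'[of a] by fastforce
  qed simp
  then show ?thesis by (simp only: adj_def)
qed

lemma twins_same_distances:
  assumes "simple_graph V E" "u \<in> V" "v \<in> V"
    and twins: "\<And>y. y \<noteq> u \<Longrightarrow> y \<noteq> v \<Longrightarrow> {u, y} \<in> E \<longleftrightarrow> {v, y} \<in> E"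
  shows "transmission V E u = transmission V E v"
    and "w \<in> V \<Longrightarrow> w \<noteq> u \<Longrightarrow> w \<noteq> v \<Longrightarrow> graph_dist V E u w = graph_dist V E v w"
proof -
  let ?f = "Transposition.transpose u v"
  have f: "bij_betw ?f V V"
    by (rule permutes_imp_bij[OF permutes_swap_id[OF assms(2,3)]])
  note edges = transpose_twins_edge[OF assms(1) twins]
  show "transmission V E u = transmission V E v"
    using transmission_automorphism[OF f edges \<open>u \<in> V\<close>] by simp
  show "graph_dist V E u w = graph_dist V E v w" if "w \<in> V" "w \<noteq> u" "w \<noteq> v"
    using graph_dist_automorphism[OF f edges \<open>u \<in> V\<close> \<open>w \<in> V\<close>] that by simp
qed

text \<open>Vertices of \<open>H\<close> are adjacent to all other vertices of \<open>H\<close>, and outside of \<open>H\<close> exactly to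
  the common neighbourhood \<open>N\<close>.\<close>

lemma twins_in_uniform_clique:
  assumes "simple_graph V E" "is_clique V E H"
    and nbh: "\<forall>v\<in>H. neighborhood V E v - H = N"
    and "u \<in> H" "v \<in> H" "y \<noteq> u" "y \<noteq> v"
  shows "{u, y} \<in> E \<longleftrightarrow> {v, y} \<in> E"
proof (cases "y \<in> H")
  case True
  then show ?thesis using assms by (auto simp: is_clique_def)
next
  case False
  have "{x, y} \<in> E \<longleftrightarrow> y \<in> N" if "x \<in> H" for x
  proof -
    have "neighborhood V E x - H = N" using nbh that by simp
    then have "y \<in> N \<longleftrightarrow> y \<in> V \<and> {x, y} \<in> E"
      using False by (auto simp: neighborhood_def insert_commute[of x y])
    moreover have "y \<in> V" if "{x, y} \<in> E" using assms(1) that by (auto simp: simple_graph_def)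
    ultimately show ?thesis by blast
  qed
  then show ?thesis using assms(4,5) by simp
qed

section \<open>Multiplicities from differences of rows\<close>

text \<open>Subtracting row \<open>k\<close> of \<open>x I - A\<close> from the rows in \<open>J\<close> is multiplication from the left by
  a matrix \<open>P\<close>. Since row \<open>i \<in> J\<close> becomes \<open>(x - c) (e\<^sub>i - e\<^sub>k)\<close>, the product also has the form
  \<open>D C\<close> with \<open>D\<close> diagonal and \<open>det D = (x - c)\<^bsup>card J\<^esup>\<close>. Requiring \<open>k\<close> to precede all elements of
  \<open>J\<close> makes \<open>P\<close> lower triangular with unit diagonal.\<close>

lemma char_poly_dvd_if_row_differences:
  fixes A :: "'a :: idom mat"
  assumes A: "A \<in> carrier_mat n n"
    and J: "J \<subseteq> {..<n}" and k: "\<And>i. i \<in> J \<Longrightarrow> k < i"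
    and rows: "\<And>i j. i \<in> J \<Longrightarrow> j < n \<Longrightarrow>
      A $$ (i, j) - A $$ (k, j) = (if j = i then c else if j = k then - c else 0)"
  shows "[:- c, 1:] ^ card J dvd char_poly A"
proof -
  define B where "B = char_poly_matrix A"
  define d :: "nat \<Rightarrow> 'a poly vec" where "d i = unit_vec n i - unit_vec n k" for i
  define P where "P = mat_of_rows n (map (\<lambda>i. if i \<in> J then d i else unit_vec n i) [0..<n])"
  define C where "C = mat_of_rows n (map (\<lambda>i. if i \<in> J then d i else row B i) [0..<n])"
  define D where "D = mat_diag n (\<lambda>i. if i \<in> J then [:- c, 1:] else 1)"
  have B: "B \<in> carrier_mat n n" using A by (simp add: B_def)
  have P: "P \<in> carrier_mat n n" and C: "C \<in> carrier_mat n n" and D: "D \<in> carrier_mat n n"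
    by (auto simp: P_def C_def D_def)
  have B_entry: "B $$ (i, j) = (if i = j then [:0, 1:] else 0) - [:A $$ (i, j):]"
    if "i < n" "j < n" for i j
    using that A by (simp add: B_def char_poly_matrix_def)
  have DC_entry: "(D * C) $$ (i, j) = (if i \<in> J then [:- c, 1:] else 1) * C $$ (i, j)"
    if "i < n" "j < n" for i j
    unfolding D_def mat_diag_mult_left[OF C] using that by simp
  have "P * B = D * C"
  proof (rule eq_matI)
    fix i j assume "i < dim_row (D * C)" "j < dim_col (D * C)"
    then have ij: "i < n" "j < n" using C D by auto
    show "(P * B) $$ (i, j) = (D * C) $$ (i, j)"
    proof (cases "i \<in> J")
      case True
      have kn: "k < n" using k[OF True] ij by simp
      have "(P * B) $$ (i, j) = d i \<bullet> col B j"
        using ij P B True by (simp add: P_def d_def)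
      also have "\<dots> = B $$ (i, j) - B $$ (k, j)"
        using ij kn B by (simp add: d_def minus_scalar_prod_distrib[where n = n])
      also have "\<dots> = [:- c, 1:] * d i $ j"
      proof -
        have "A $$ (i, j) = A $$ (k, j) + (if j = i then c else if j = k then - c else 0)"
          using rows[OF True ij(2)] by (simp add: algebra_simps)
        then show ?thesis
          using ij kn k[OF True] by (auto simp: B_entry d_def one_pCons)
      qed
      also have "\<dots> = (D * C) $$ (i, j)"
        unfolding DC_entry[OF ij] using ij True by (simp add: C_def mat_of_rows_index)
      finally show ?thesis .
    next
      case False
      have "(P * B) $$ (i, j) = unit_vec n i \<bullet> col B j"
        using ij P B False by (simp add: P_def)
      also have "\<dots> = (D * C) $$ (i, j)"
        unfolding DC_entry[OF ij] using ij False B by (simp add: C_def mat_of_rows_index)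
      finally show ?thesis .
    qed
  qed (use P B C D in auto)
  then have "det P * det B = det D * det C"
    using det_mult[OF P B] det_mult[OF D C] by simp
  moreover have "det P = 1"
  proof -
    have "P $$ (i, j) = 0" if "i < j" "j < n" for i j
      using that k[of i] by (auto simp: P_def d_def mat_of_rows_index)
    then have "det P = prod_list (diag_mat P)"
      using P det_lower_triangular by blast
    also have "diag_mat P = map (\<lambda>i. 1) [0..<n]"
    proof -
      have "unit_vec n k $ i = (0 :: 'a poly)" if "i \<in> J" "i < n" for i
        using k[OF that(1)] that(2) by simp
      then show ?thesis
        using P by (auto simp: diag_mat_def P_def d_def mat_of_rows_index)
    qed
    finally show ?thesis by (simp add: map_replicate_const)
  qed
  moreover have "det D = [:- c, 1:] ^ card J"
  proof -
    have "det D = prod_list (diag_mat D)"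
      by (rule det_upper_triangular[OF _ D]) (auto simp: upper_triangular_def D_def mat_diag_def)
    also have "diag_mat D = map (\<lambda>i. if i \<in> J then [:- c, 1:] else 1) [0..<n]"
      by (auto simp: diag_mat_def D_def mat_diag_def)
    also have "prod_list \<dots> = (\<Prod>i\<in>{..<n}. if i \<in> J then [:- c, 1:] else 1)"
      using prod.distinct_set_conv_list[of "[0..<n]" "\<lambda>i. if i \<in> J then [:- c, 1:] else 1"]
      by (simp add: atLeast0LessThan)
    also have "\<dots> = (\<Prod>i\<in>{..<n} \<inter> J. [:- c, 1:])"
      by (rule prod.inter_restrict[symmetric]) simp
    also have "{..<n} \<inter> J = J" using J by blast
    finally show ?thesis by simp
  qed
  ultimately show ?thesis by (simp add: char_poly_def B_def)
qed

lemma count_proots_char_poly_ge: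
  fixes A :: "'a :: field mat"
  assumes "A \<in> carrier_mat n n" "[:- c, 1:] ^ m dvd char_poly A"
  shows "m \<le> count (proots (char_poly A)) c"
proof -
  have "char_poly A \<noteq> 0" using degree_monic_char_poly[OF assms(1)] by auto
  then show ?thesis using assms(2) by (simp add: order_max)
qed

lemma distance_laplacian_carrier:
  "distance_laplacian V E vs \<in> carrier_mat (length vs) (length vs)"
  unfolding distance_laplacian_def distance_matrix_def mat_diag_def
  by (rule minus_carrier_mat) simp

text \<open>In row \<open>u\<close> minus row \<open>v\<close>, for \<open>u, v \<in> H\<close>, the entry in column \<open>u\<close> is the diagonal entry \<open>t\<close>
  minus the off-diagonal entry \<open>- 1\<close> of two adjacent vertices; column \<open>v\<close> has the opposite value,
  and elsewhere the equal distances cancel.\<close>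

lemma uniform_clique_eigenvalue_multiplicity:
  assumes conn: "connected_graph V E"
    and vs: "distinct vs" "set vs = V"
    and H: "is_clique V E H"
    and nbh: "\<forall>v\<in>H. neighborhood V E v - H = N"
    and t: "\<And>v. v \<in> H \<Longrightarrow> transmission V E v = t"
  shows "card H - 1 \<le> count (dl_eigenvalues V E vs) (real t + 1)"
proof (cases "H = {}")
  case False
  define n where "n = length vs"
  define A where "A = distance_laplacian V E vs"
  define I where "I = {i. i < n \<and> vs ! i \<in> H}"
  \<comment> \<open>the row to be subtracted; minimality is what the row operations require\<close>
  define k where "k = Min I"
  define J where "J = I - {k}"
  have simple: "simple_graph V E" using conn by (simp add: connected_graph_def)
  have HV: "H \<subseteq> V" using H by (simp add: is_clique_def)
  have A: "A \<in> carrier_mat n n"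
    by (simp add: A_def n_def distance_laplacian_carrier)
  have bij: "bij_betw ((!) vs) I H"
  proof (rule bij_betwI')
    show "\<exists>i\<in>I. v = vs ! i" if "v \<in> H" for v
    proof -
      from that HV vs have "v \<in> set vs" by blast
      then obtain i where "i < length vs" "vs ! i = v" by (auto simp: in_set_conv_nth)
      with that show ?thesis by (auto simp: I_def n_def)
    qed
  qed (use vs in \<open>auto simp: I_def n_def nth_eq_iff_index_eq\<close>)
  have finI: "finite I" by (simp add: I_def)
  have "I \<noteq> {}" using bij False by (auto simp: bij_betw_def)
  with finI have k: "k \<in> I" and k_le: "\<And>i. i \<in> I \<Longrightarrow> k \<le> i" by (auto simp: k_def)
  have cardJ: "card J = card H - 1"
    using k finI bij_betw_same_card[OF bij] by (simp add: J_def)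
  have entry: "A $$ (i, j) = (if i = j then real (transmission V E (vs ! i)) else 0)
      - real (graph_dist V E (vs ! i) (vs ! j))" if "i < n" "j < n" for i j
    using that by (simp add: A_def distance_laplacian_def distance_matrix_def mat_diag_def n_def)
  have "[:- (real t + 1), 1:] ^ card J dvd char_poly A"
  proof (rule char_poly_dvd_if_row_differences[OF A, where k = k])
    show "J \<subseteq> {..<n}" by (auto simp: J_def I_def)
    show "k < i" if "i \<in> J" for i using that k_le[of i] by (auto simp: J_def)
    fix i j assume i: "i \<in> J" and j: "j < n"
    let ?u = "vs ! i" and ?v = "vs ! k" and ?w = "vs ! j"
    have ik: "i < n" "k < n" "i \<noteq> k" and uv: "?u \<in> H" "?v \<in> H"
      using i k by (auto simp: J_def I_def)
    have V: "?u \<in> V" "?v \<in> V" "?w \<in> V" using uv HV j vs by (auto simp: n_def)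
    have idx: "?u \<noteq> ?v" "?w = ?u \<longleftrightarrow> j = i" "?w = ?v \<longleftrightarrow> j = k"
      using vs ik j by (auto simp: n_def nth_eq_iff_index_eq)
    note twins = twins_in_uniform_clique[OF simple H nbh uv]
    have third: "graph_dist V E ?u ?w = graph_dist V E ?v ?w" if "j \<noteq> i" "j \<noteq> k"
      using twins_same_distances(2)[OF simple V(1,2) twins V(3)] that idx by blast
    have adj: "graph_dist V E ?u ?v = 1" "graph_dist V E ?v ?u = 1"
      using graph_dist_adjacent[OF conn] idx(1) uv V H by (auto simp: is_clique_def)
    show "A $$ (i, j) - A $$ (k, j) =
      (if j = i then real t + 1 else if j = k then - (real t + 1) else 0)"
      using ik j third adj t[OF uv(1)] t[OF uv(2)]
      by (auto simp: entry graph_dist_self[OF V(1)] graph_dist_self[OF V(2)])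
  qed
  from count_proots_char_poly_ge[OF A this] show ?thesis
    by (simp add: cardJ dl_eigenvalues_def A_def)
qed simp

section \<open>The size of the eigenvalue\<close>

text \<open>The distances from \<open>v\<close> add up to at least
  \<open>(card H - 1) + card N + 2 (card V - card H - card N)\<close>.\<close>

lemma transmission_lower_bound:
  assumes conn: "connected_graph V E"
    and HV: "H \<subseteq> V" and N: "N \<subseteq> V - H"
    and nbh: "neighborhood V E v - H = N" and v: "v \<in> H"
  shows "2 * real (card V) - real (card H) - real (card N) \<le> real (transmission V E v) + 1"
proof -
  define R where "R = V - (H \<union> N)"
  let ?d = "\<lambda>u. graph_dist V E u v"
  have fin: "finite V" using conn by (simp add: connected_graph_def simple_graph_def)
  have finHN: "finite H" "finite N" "finite R"
    using fin HV N by (auto simp: R_def intro: finite_subset)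
  have disj: "(H - {v}) \<inter> N = {}" "((H - {v}) \<union> N) \<inter> R = {}"
    using N by (auto simp: R_def)
  have split: "V = insert v (((H - {v}) \<union> N) \<union> R)" and vnot: "v \<notin> ((H - {v}) \<union> N) \<union> R"
    using HV N v by (auto simp: R_def)
  have "transmission V E v = ?d v + (sum ?d (H - {v}) + sum ?d N + sum ?d R)"
    unfolding transmission_def
    by (subst split, subst sum.insert) (use finHN vnot disj in \<open>simp_all add: sum.union_disjoint\<close>)
  moreover have "card (H - {v}) \<le> sum ?d (H - {v})"
    using sum_mono[of "H - {v}" "\<lambda>_. 1" ?d] graph_dist_ge_1[OF conn] HV v by auto
  moreover have "card N \<le> sum ?d N"
    using sum_mono[of N "\<lambda>_. 1" ?d] graph_dist_ge_1[OF conn] HV N v by fastforce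
  moreover have "2 * card R \<le> sum ?d R"
  proof -
    have "2 \<le> ?d u" if "u \<in> R" for u
    proof (rule graph_dist_ge_2[OF conn])
      show "u \<in> V" "v \<in> V" "u \<noteq> v" using that HV v by (auto simp: R_def)
      show "{u, v} \<notin> E" using that nbh by (auto simp: R_def neighborhood_def)
    qed
    then show ?thesis using sum_mono[of R "\<lambda>_. 2" ?d] by simp
  qed
  moreover have "card V = card H + card N + card R"
  proof -
    have "V = (H \<union> N) \<union> R" using HV N by (auto simp: R_def)
    moreover have "H \<inter> N = {}" "(H \<union> N) \<inter> R = {}" using N by (auto simp: R_def)
    then have "card ((H \<union> N) \<union> R) = card H + card N + card R"
      using finHN by (simp add: card_Un_disjoint)
    ultimately show ?thesis by simp
  qed
  moreover have "card (H - {v}) + 1 = card H"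
    using v finHN by (metis Suc_eq_plus1 card_Suc_Diff1)
  ultimately show ?thesis by linarith
qed

lemma dl_eig_1_ge:
  assumes "x \<in># dl_eigenvalues V E vs"
  shows "x \<le> dl_eig V E vs 1"
proof -
  let ?xs = "sorted_list_of_multiset (dl_eigenvalues V E vs)"
  from assms have "x \<in> set ?xs" by simp
  then obtain i where i: "i < length ?xs" "x = ?xs ! i" by (metis in_set_conv_nth)
  then have "x \<le> ?xs ! (length ?xs - 1)"
    by (auto intro!: sorted_nth_mono)
  moreover have "0 < length ?xs" using i(1) by linarith
  ultimately show ?thesis by (simp only: dl_eig_def rev_nth diff_self_eq_0 One_nat_def)
qed

lemma dl_count_ge_count:
  assumes "x \<in> I"
  shows "count (dl_eigenvalues V E vs) x \<le> dl_count V E vs I"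
  using assms count_le_size[of "filter_mset (\<lambda>x. x \<in> I) (dl_eigenvalues V E vs)" x]
  by (simp add: dl_count_def)

theorem theorem4p1:
  fixes V H N R :: "'a set" and E :: "'a set set" and vs :: "'a list"
    and n s chi :: nat and b :: real
  assumes "connected_graph V E"
    and "distinct vs" and "set vs = V"
    and "n = card V"
    and "chi = chromatic_number V E"
    and "b = real n + real_of_int \<lceil>real n / real chi\<rceil>"
    and "is_clique V E H"
    and "s = card H" and "s \<ge> 2"
    and "N \<subseteq> V - H"
    and "\<forall>v\<in>H. neighborhood V E v - H = N"
    and "R = V - (H \<union> N)"
  shows "int (card R) = int n - int s - int (card N) \<and>
    (\<exists>lam :: real.
      (\<forall>v\<in>H. lam = real (transmission V E v) + 1) \<and>
      (eigenvalue (distance_laplacian V E vs) lam \<and>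
        count (dl_eigenvalues V E vs) lam \<ge> s - 1) \<and>
      lam \<ge> 2 * real n - real s - real (card N) \<and>
      (int s + int (card N) \<le> int n - \<lceil>real n / real chi\<rceil> \<longrightarrow>
        lam \<ge> b \<and>
        dl_count V E vs {b..dl_eig V E vs 1} \<ge> s - 1))"
proof -
  have simple: "simple_graph V E" and fin: "finite V" and HV: "H \<subseteq> V"
    using assms(1,7) by (auto simp: connected_graph_def simple_graph_def is_clique_def)
  obtain w where w: "w \<in> H" using assms(8,9) by fastforce
  define lam where "lam = real (transmission V E w) + 1"
  have trans: "transmission V E v = transmission V E w" if "v \<in> H" for v
    using twins_same_distances(1)[OF simple _ _ twins_in_uniform_clique[OF simple assms(7,11)]]
      that w HV by blast
  have mult: "s - 1 \<le> count (dl_eigenvalues V E vs) lam"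
    unfolding lam_def assms(8)
    by (rule uniform_clique_eigenvalue_multiplicity[OF assms(1,2,3,7,11) trans])
  then have lam_in: "lam \<in># dl_eigenvalues V E vs"
    using assms(9) by (simp flip: count_greater_zero_iff)
  have "poly (char_poly (distance_laplacian V E vs)) lam = 0"
  proof -
    have "char_poly (distance_laplacian V E vs) \<noteq> 0"
      using degree_monic_char_poly[OF distance_laplacian_carrier[of V E vs]] by auto
    then show ?thesis using lam_in by (simp add: dl_eigenvalues_def)
  qed
  then have eig: "eigenvalue (distance_laplacian V E vs) lam"
    by (simp add: eigenvalue_root_char_poly[OF distance_laplacian_carrier])
  have bound: "2 * real n - real s - real (card N) \<le> lam"
    unfolding lam_def assms(4,8)
    by (rule transmission_lower_bound) (use assms HV w in auto)
  have last: "b \<le> lam \<and> s - 1 \<le> dl_count V E vs {b..dl_eig V E vs 1}"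
    if "int s + int (card N) \<le> int n - \<lceil>real n / real chi\<rceil>"
  proof -
    have "b \<le> lam" using bound that unfolding assms(6) by linarith
    then have "lam \<in> {b..dl_eig V E vs 1}" using dl_eig_1_ge[OF lam_in] by simp
    from dl_count_ge_count[OF this, of V E vs] mult \<open>b \<le> lam\<close> show ?thesis by linarith
  qed
  have "card R = card V - (card H + card N)" "card H + card N \<le> card V"
  proof -
    have HN: "finite H" "finite N" "H \<inter> N = {}" "H \<union> N \<subseteq> V"
      using HV assms(10) fin by (auto intro: finite_subset)
    then have "card (H \<union> N) = card H + card N" by (simp add: card_Un_disjoint)
    with HN fin show "card R = card V - (card H + card N)" "card H + card N \<le> card V"
      unfolding assms(12) using card_Diff_subset[of "H \<union> N" V] card_mono[OF fin HN(4)] by simp_all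
  qed
  then have "int (card R) = int n - int s - int (card N)"
    using assms(4,8) by simp
  moreover have "\<forall>v\<in>H. lam = real (transmission V E v) + 1"
    using trans by (simp add: lam_def)
  ultimately show ?thesis using mult eig bound last by (intro conjI exI[of _ lam]) auto
qed

end
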